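(* Let $r>1$ and $s>1$ be real numbers with $\frac{1}{r}+\frac{1}{s}=1$. Let $n\ge 1$ be an integer, let $a_0,a_1,\dots,a_{n-1}\in\mathbb{H}$ be quaternions, and let $f(q)=q^{n}+a_{n-1}q^{n-1}+\cdots+a_{1}q+a_{0}$ be the corresponding polynomial in the quaternionic variable $q$. Then all the zeros of $f$ (i.e. all $q\in\mathbb{H}$ with $f(q)=0$) lie in the ball $$|q|\le\left\{1+\left[\sum_{\nu=0}^{n-1}|a_\nu|^{r}\right]^{\frac{s}{r}}\right\}^{\frac{1}{s}},$$ and also in the ball $$|q|\le\left[1+n^{\frac{s}{r}}M^{s}\right]^{\frac{1}{s}},$$ where $M=\max_{0\le\nu\le n-1}|a_\nu|$.
   Context: $\mathbb{H}=\{\alpha+\beta i+\gamma j+\delta k:\alpha,\beta,\gamma,\delta\in\mathbb{R}\}$ denotes the (non-commutative) real quaternions, with $i^2=j^2=k^2=ijk=-1$. For $q=\alpha+\beta i+\gamma j+\delta k$, the norm is $|q|=\sqrt{q\bar q}=\sqrt{\alpha^2+\beta^2+\gamma^2+\delta^2}$. The polynomial has its coefficients on the left of the powers of $q$, and $f(q)$ is evaluated by substituting the quaternion $q$ in this expression. *)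

theory Defs
  imports "HOL-Analysis.Analysis"
begin

text \<open>
  The real quaternions: \<open>Quat \<alpha> \<beta> \<gamma> \<delta>\<close> stands for \<open>\<alpha> + \<beta> i + \<gamma> j + \<delta> k\<close>.
  The product is the bilinear one determined by \<open>i\<^sup>2 = j\<^sup>2 = k\<^sup>2 = ijk = -1\<close>; these relations and
  this decomposition are the lemmas \<open>quat_units\<close> and \<open>Quat_eq\<close> below, and the identity
  \<open>\<bar>q\<bar>\<^sup>2 = q * qcnj q\<close> is \<open>quat_mult_cnj\<close>.
\<close>

datatype quat = Quat (q1: real) (qi: real) (qj: real) (qk: real)

lemma quat_eq_iff: "x = y \<longleftrightarrow> q1 x = q1 y \<and> qi x = qi y \<and> qj x = qj y \<and> qk x = qk y"
  by (cases x; cases y) simp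

instantiation quat :: ab_group_add
begin

definition "0 = Quat 0 0 0 0"
definition "x + y = Quat (q1 x + q1 y) (qi x + qi y) (qj x + qj y) (qk x + qk y)"
definition "- x = Quat (- q1 x) (- qi x) (- qj x) (- qk x)"
definition "x - y = Quat (q1 x - q1 y) (qi x - qi y) (qj x - qj y) (qk x - qk y)"

instance
  by standard
    (simp_all add: quat_eq_iff zero_quat_def plus_quat_def uminus_quat_def minus_quat_def)

end

lemma quat_zero_sel [simp]: "q1 0 = 0" "qi 0 = 0" "qj 0 = 0" "qk 0 = 0"
  by (simp_all add: zero_quat_def)

lemma quat_add_sel [simp]:
  "q1 (x + y) = q1 x + q1 y" "qi (x + y) = qi x + qi y"
  "qj (x + y) = qj x + qj y" "qk (x + y) = qk x + qk y"
  by (simp_all add: plus_quat_def)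

lemma quat_uminus_sel [simp]:
  "q1 (- x) = - q1 x" "qi (- x) = - qi x" "qj (- x) = - qj x" "qk (- x) = - qk x"
  by (simp_all add: uminus_quat_def)

lemma quat_minus_sel [simp]:
  "q1 (x - y) = q1 x - q1 y" "qi (x - y) = qi x - qi y"
  "qj (x - y) = qj x - qj y" "qk (x - y) = qk x - qk y"
  by (simp_all add: minus_quat_def)

instantiation quat :: ring_1
begin

definition "1 = Quat 1 0 0 0"
definition "x * y = Quat
  (q1 x * q1 y - qi x * qi y - qj x * qj y - qk x * qk y)
  (q1 x * qi y + qi x * q1 y + qj x * qk y - qk x * qj y)
  (q1 x * qj y - qi x * qk y + qj x * q1 y + qk x * qi y)
  (q1 x * qk y + qi x * qj y - qj x * qi y + qk x * q1 y)"

instance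
  by standard (simp_all add: quat_eq_iff one_quat_def times_quat_def algebra_simps)

end

lemma quat_one_sel [simp]: "q1 1 = 1" "qi 1 = 0" "qj 1 = 0" "qk 1 = 0"
  by (simp_all add: one_quat_def)

lemma quat_mult_sel [simp]:
  "q1 (x * y) = q1 x * q1 y - qi x * qi y - qj x * qj y - qk x * qk y"
  "qi (x * y) = q1 x * qi y + qi x * q1 y + qj x * qk y - qk x * qj y"
  "qj (x * y) = q1 x * qj y - qi x * qk y + qj x * q1 y + qk x * qi y"
  "qk (x * y) = q1 x * qk y + qi x * qj y - qj x * qi y + qk x * q1 y"
  by (simp_all add: times_quat_def)

instantiation quat :: real_algebra_1
begin

definition "c *\<^sub>R x = Quat (c * q1 x) (c * qi x) (c * qj x) (c * qk x)"

instance
  by standard (simp_all add: quat_eq_iff scaleR_quat_def algebra_simps)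

end

lemma quat_scaleR_sel [simp]:
  "q1 (c *\<^sub>R x) = c * q1 x" "qi (c *\<^sub>R x) = c * qi x"
  "qj (c *\<^sub>R x) = c * qj x" "qk (c *\<^sub>R x) = c * qk x"
  by (simp_all add: scaleR_quat_def)

lemma quat_of_real_sel [simp]:
  "q1 (of_real c) = c" "qi (of_real c) = 0" "qj (of_real c) = 0" "qk (of_real c) = 0"
  by (simp_all add: of_real_def)

definition qcnj :: "quat \<Rightarrow> quat"
  where "qcnj x = Quat (q1 x) (- qi x) (- qj x) (- qk x)"

instantiation quat :: real_inner
begin

definition "inner x y = q1 x * q1 y + qi x * qi y + qj x * qj y + qk x * qk y"
definition "norm x = sqrt ((q1 x)\<^sup>2 + (qi x)\<^sup>2 + (qj x)\<^sup>2 + (qk x)\<^sup>2)"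
definition "sgn x = x /\<^sub>R norm (x :: quat)"
definition "dist x y = norm (x - y :: quat)"
definition [code del]:
  "(uniformity :: (quat \<times> quat) filter) = (INF e\<in>{0 <..}. principal {(x, y). dist x y < e})"
definition [code del]:
  "open (U :: quat set) \<longleftrightarrow> (\<forall>x\<in>U. eventually (\<lambda>(x', y). x' = x \<longrightarrow> y \<in> U) uniformity)"

instance
proof
  fix x y z :: quat and c :: real and U :: "quat set"
  show "dist x y = norm (x - y)"
    by (rule dist_quat_def)
  show "sgn x = x /\<^sub>R norm x"
    by (rule sgn_quat_def)
  show "uniformity = (INF e\<in>{0 <..}. principal {(x, y). dist x (y :: quat) < e})"
    by (rule uniformity_quat_def)
  show "open U \<longleftrightarrow> (\<forall>x\<in>U. eventually (\<lambda>(x', y). x' = x \<longrightarrow> y \<in> U) uniformity)"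
    by (rule open_quat_def)
  show "inner x y = inner y x"
    by (simp add: inner_quat_def mult.commute)
  show "inner (x + y) z = inner x z + inner y z"
    by (simp add: inner_quat_def algebra_simps)
  show "inner (c *\<^sub>R x) y = c * inner x y"
    by (simp add: inner_quat_def algebra_simps)
  show "0 \<le> inner x x"
    by (simp add: inner_quat_def)
  show "inner x x = 0 \<longleftrightarrow> x = 0"
    by (auto simp: inner_quat_def quat_eq_iff add_nonneg_eq_0_iff)
  show "norm x = sqrt (inner x x)"
    by (simp add: inner_quat_def norm_quat_def power2_eq_square)
qed

end

lemma quat_mult_cnj: "x * qcnj x = of_real ((norm x)\<^sup>2)"
  by (simp add: quat_eq_iff qcnj_def norm_quat_def power2_eq_square)

instantiation quat :: real_normed_div_algebra
begin

definition "inverse x = qcnj x /\<^sub>R (norm x)\<^sup>2"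
definition "x div y = x * inverse (y :: quat)"

instance
proof
  fix x y :: quat
  show "norm (x * y) = norm x * norm y"
    unfolding norm_quat_def real_sqrt_mult [symmetric]
    by (rule arg_cong [where f = sqrt])
      (simp add: power2_eq_square algebra_simps)
  show "x div y = x * inverse y"
    by (rule divide_quat_def)
  show "inverse (0 :: quat) = 0"
    by (simp add: inverse_quat_def)
  assume "x \<noteq> 0"
  then have "(q1 x)\<^sup>2 + (qi x)\<^sup>2 + (qj x)\<^sup>2 + (qk x)\<^sup>2 \<noteq> 0"
    by (auto simp: quat_eq_iff add_nonneg_eq_0_iff)
  moreover have "(norm x)\<^sup>2 = (q1 x)\<^sup>2 + (qi x)\<^sup>2 + (qj x)\<^sup>2 + (qk x)\<^sup>2"
    by (simp add: norm_quat_def)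
  ultimately show "inverse x * x = 1" and "x * inverse x = 1"
    by (simp_all add: inverse_quat_def quat_eq_iff qcnj_def field_simps power2_eq_square)
qed

end

definition quat_i :: quat where "quat_i = Quat 0 1 0 0"
definition quat_j :: quat where "quat_j = Quat 0 0 1 0"
definition quat_k :: quat where "quat_k = Quat 0 0 0 1"

lemma quat_units:
  "quat_i\<^sup>2 = - 1" "quat_j\<^sup>2 = - 1" "quat_k\<^sup>2 = - 1" "quat_i * quat_j * quat_k = - 1"
  by (simp_all add: quat_eq_iff quat_i_def quat_j_def quat_k_def power2_eq_square)

lemma Quat_eq: "Quat \<alpha> \<beta> \<gamma> \<delta> =
    of_real \<alpha> + of_real \<beta> * quat_i + of_real \<gamma> * quat_j + of_real \<delta> * quat_k"
  by (simp add: quat_eq_iff quat_i_def quat_j_def quat_k_def)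

end

theory Submission imports Defs begin

text \<open>
  A zero \<open>q\<close> with \<open>y = \<bar>q\<bar>\<^sup>s > 1\<close> satisfies \<open>\<bar>q\<bar>\<^sup>n \<le> \<Sum>\<nu><n. \<bar>a\<^sub>\<nu>\<bar> \<bar>q\<bar>\<^sup>\<nu>\<close>. Hoelder's inequality
  and the geometric sum turn this into \<open>y\<^sup>n \<le> A\<^sup>s (y\<^sup>n - 1) / (y - 1)\<close>, where \<open>A\<close> is the
  \<open>r\<close>-norm of the coefficients, and hence \<open>y \<le> 1 + A\<^sup>s\<close>.
\<close>

text \<open>Young's inequality, applied termwise after dividing \<open>f\<close> and
  \<open>g\<close> by their \<open>r\<close>- and \<open>s\<close>-norms \<open>A\<close> and
  \<open>B\<close>, bounds the normalised sum by 1/r + 1/s = 1.\<close>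

lemma Holder_inequality_sum:
  fixes f g :: "'a \<Rightarrow> real" and r s :: real
  assumes "finite I" and r: "r > 1" and s: "s > 1" and rs: "1 / r + 1 / s = 1"
    and f: "\<And>i. i \<in> I \<Longrightarrow> 0 \<le> f i" and g: "\<And>i. i \<in> I \<Longrightarrow> 0 \<le> g i"
  shows "(\<Sum>i\<in>I. f i * g i)
    \<le> (\<Sum>i\<in>I. f i powr r) powr (1 / r) * (\<Sum>i\<in>I. g i powr s) powr (1 / s)"
proof -
  let ?F = "\<Sum>i\<in>I. f i powr r" and ?G = "\<Sum>i\<in>I. g i powr s"
  define A where "A = ?F powr (1 / r)"
  define B where "B = ?G powr (1 / s)"
  show ?thesis
  \<comment> \<open>Normalising needs \<open>A\<close> and \<open>B\<close> nonzero. If either power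
    sum vanishes, so does every \<open>f i\<close> or every \<open>g i\<close>, and with it the
    left-hand side.\<close>
  proof (cases "?F = 0 \<or> ?G = 0")
    case True
    then have "(\<Sum>i\<in>I. f i * g i) = 0"
      using \<open>finite I\<close> by (intro sum.neutral) (auto simp: sum_nonneg_eq_0_iff)
    then show ?thesis
      by simp
  next
    case False
    have "?F \<ge> 0" "?G \<ge> 0"
      by (simp_all add: sum_nonneg)
    with False have pos: "A > 0" "B > 0"
      by (simp_all add: A_def B_def)
    have A: "A powr r = ?F" and B: "B powr s = ?G"
      using r s \<open>?F \<ge> 0\<close> \<open>?G \<ge> 0\<close> by (simp_all add: A_def B_def powr_powr)
    have "(\<Sum>i\<in>I. f i / A * (g i / B)) \<le> (\<Sum>i\<in>I. (f i / A) powr r / r + (g i / B) powr s / s)"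
      using r s rs f g pos by (intro sum_mono Youngs_inequality) auto
    also have "\<dots> = (\<Sum>i\<in>I. f i powr r / ?F / r + g i powr s / ?G / s)"
      using f g pos by (intro sum.cong) (auto simp: powr_divide A B)
    also have "\<dots> = 1"
      using False rs by (simp add: sum.distrib flip: sum_divide_distrib)
    finally have "(\<Sum>i\<in>I. f i * g i) / (A * B) \<le> 1"
      by (simp add: sum_divide_distrib)
    then show ?thesis
      using pos by (simp add: A_def B_def)
  qed
qed

text \<open>Since the norm is multiplicative, the root equation becomes an inequality between real
  numbers, whence the setting of a real normed division algebra.\<close>

lemma norm_monic_polynomial_root_le:
  fixes a :: "nat \<Rightarrow> 'a::real_normed_div_algebra" and r s :: real
  assumes r: "r > 1" and s: "s > 1" and rs: "1 / r + 1 / s = 1"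
    and root: "q ^ n + (\<Sum>\<nu><n. a \<nu> * q ^ \<nu>) = 0"
  shows "norm q \<le> (1 + (\<Sum>\<nu><n. norm (a \<nu>) powr r) powr (s / r)) powr (1 / s)"
proof -
  define S where "S = (\<Sum>\<nu><n. norm (a \<nu>) powr r)"
  define y where "y = norm q powr s"
  \<comment> \<open>The natural power stays inside \<open>powr\<close>, so the case
    \<open>q = 0\<close>, \<open>k = 0\<close> gives 1 on both sides, whereas
    \<open>0 powr 0\<close> is 0.\<close>
  have y_power: "(norm q ^ k) powr s = y ^ k" for k
    by (induction k) (simp_all add: y_def powr_mult)
  have "y \<le> 1 + S powr (s / r)"
  \<comment> \<open>The bound is at least 1, so only \<open>y > 1\<close> matters; there
    \<open>y - 1\<close> is a positive denominator for the geometric sum.\<close>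
  proof (cases "y > 1")
    case False
    then show ?thesis
      using powr_ge_zero [of S "s / r"] by linarith
  next
    case True
    have "norm q ^ n = norm (\<Sum>\<nu><n. a \<nu> * q ^ \<nu>)"
      by (metis root add.commute add_eq_0_iff norm_minus_cancel norm_power)
    also have "\<dots> \<le> (\<Sum>\<nu><n. norm (a \<nu>) * norm q ^ \<nu>)"
      by (rule norm_sum [THEN order_trans]) (simp add: norm_mult norm_power)
    also have "\<dots> \<le> S powr (1 / r) * (\<Sum>\<nu><n. (norm q ^ \<nu>) powr s) powr (1 / s)"
      unfolding S_def using r s rs by (intro Holder_inequality_sum) auto
    finally have "norm q ^ n \<le> S powr (1 / r) * (\<Sum>\<nu><n. y ^ \<nu>) powr (1 / s)"
      by (simp add: y_power)
    then have "(norm q ^ n) powr s \<le> (S powr (1 / r) * (\<Sum>\<nu><n. y ^ \<nu>) powr (1 / s)) powr s"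
      using s by (intro powr_mono2) auto
    also have "\<dots> = S powr (s / r) * (\<Sum>\<nu><n. y ^ \<nu>)"
      using s True by (simp add: powr_mult powr_powr sum_nonneg)
    also have "(\<Sum>\<nu><n. y ^ \<nu>) = (y ^ n - 1) / (y - 1)"
      using True by (simp add: geometric_sum)
    \<comment> \<open>Dropping the -1 leaves a factor \<open>y ^ n\<close> on both sides, which is
      positive and cancels at the end.\<close>
    also have "S powr (s / r) * ((y ^ n - 1) / (y - 1)) \<le> S powr (s / r) * (y ^ n / (y - 1))"
      using True by (intro mult_left_mono divide_right_mono) auto
    finally have "y ^ n * (y - 1) \<le> y ^ n * S powr (s / r)"
      using True by (simp add: y_power field_simps)
    then show ?thesis
      using True by simp
  qed
  then have "y powr (1 / s) \<le> (1 + S powr (s / r)) powr (1 / s)"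
    using s by (intro powr_mono2) (auto simp: y_def)
  then show ?thesis
    using s by (simp add: S_def y_def powr_powr)
qed

theorem theorem1:
  fixes r s :: real and n :: nat and a :: "nat \<Rightarrow> quat" and f :: "quat \<Rightarrow> quat"
  assumes "r > 1" and "s > 1" and "1 / r + 1 / s = 1"
    and "n \<ge> 1"
    and f_def: "\<And>q. f q = q ^ n + (\<Sum>\<nu><n. a \<nu> * q ^ \<nu>)"
  shows "(\<forall>q. f q = 0 \<longrightarrow>
            norm q \<le> (1 + (\<Sum>\<nu><n. norm (a \<nu>) powr r) powr (s / r)) powr (1 / s))
       \<and> (\<forall>q. f q = 0 \<longrightarrow>
            norm q \<le> (1 + real n powr (s / r) * (MAX \<nu>\<in>{..<n}. norm (a \<nu>)) powr s) powr (1 / s))"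
proof -
  let ?S = "\<Sum>\<nu><n. norm (a \<nu>) powr r"
  define M where "M = (MAX \<nu>\<in>{..<n}. norm (a \<nu>))"
  have M: "norm (a \<nu>) \<le> M" if "\<nu> < n" for \<nu>
    using that by (simp add: M_def)
  \<comment> \<open>As \<open>n \<ge> 1\<close>, the index 0 is in range and
    \<open>norm (a 0)\<close> lies between 0 and \<open>M\<close>.\<close>
  then have "M \<ge> 0"
    using order_trans [OF norm_ge_zero M [of 0]] \<open>n \<ge> 1\<close> by simp
  \<comment> \<open>The second ball contains the first: each of the \<open>n\<close> summands is at
    most \<open>M powr r\<close>, and the outer exponent \<open>s / r\<close> turns this into
    \<open>M powr s\<close>.\<close>
  have "?S \<le> (\<Sum>\<nu><n. M powr r)"
    using M \<open>r > 1\<close> by (intro sum_mono powr_mono2) auto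
  then have "?S powr (s / r) \<le> (real n * M powr r) powr (s / r)"
    using \<open>r > 1\<close> \<open>s > 1\<close> by (intro powr_mono2) (auto simp: sum_nonneg)
  also have "\<dots> = real n powr (s / r) * M powr s"
    using \<open>r > 1\<close> \<open>M \<ge> 0\<close> by (simp add: powr_mult powr_powr)
  finally have "(1 + ?S powr (s / r)) powr (1 / s)
      \<le> (1 + real n powr (s / r) * M powr s) powr (1 / s)"
    using \<open>s > 1\<close> by (intro powr_mono2) auto
  moreover have "norm q \<le> (1 + ?S powr (s / r)) powr (1 / s)" if "f q = 0" for q
    using norm_monic_polynomial_root_le [of r s q n a] assms that by simp
  ultimately show ?thesis
    unfolding M_def by (blast intro: order_trans)
qed

end
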